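(* Let $K\ge 1$, $C>K$ and $Q\ge 2$ be integers, let $\epsilon\in(0,1)$, and let $G(\Delta u)\in(0,\tfrac12)$ be a constant. Consider the Markov chain approximation of the trial and error (TE) dynamics described in the context, with parameters such that its transition probabilities are at most $1$. Let $\bar T_{NE}$ be the expected number of iterations needed to reach the Nash equilibrium state for the first time, starting from the state in which no player uses an individually optimal action. Then $$\bar T_{NE}\le \frac{CQ}{\epsilon^{1+G(\Delta u)}(C-K)}\left(1+\log\left(\frac{K(C-K+1)}{C+1}\right)\right),$$ $$\bar T_{NE}\ge \frac{CQ}{\epsilon^{1+G(\Delta u)}(C-K)}\left(\gamma+\log\left(\frac{K(C-K)}{C}\right)\right),$$ where $\gamma\simeq 0.577$ is the Euler-Mascheroni constant.
   Context: There are $K$ players, $C$ orthogonal channels and $Q$ power quantization levels, so each player has $CQ$ actions; $\epsilon$ is the experimentation probability of the algorithm. The approximating discrete-time Markov chain has states indexed by the number $k\in\{0,1,\dots,K\}$ of players currently using an individually optimal ("correct") action; state $k=K$ is the Nash equilibrium (NE). While the NE has not been reached, the only possible change of state is $k\to k+1$ ($0\le k\le K-1$), which occurs at each iteration with probability $$(K-k)\,\frac{C-k}{CQ}\,\epsilon^{1+G(\Delta u)},$$ and otherwise the chain stays at $k$. $\log$ is the natural logarithm. *)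

theory Defs
  imports "HOL-Probability.Probability"
begin

text \<open>
  A transition matrix on \<open>S\<close>; the values of \<open>P\<close> outside \<open>S\<close> are irrelevant.
\<close>

definition stochastic_on :: "'s set \<Rightarrow> ('s \<Rightarrow> 's \<Rightarrow> real) \<Rightarrow> bool" where
  "stochastic_on S P \<longleftrightarrow>
     (\<forall>i\<in>S. (\<forall>j\<in>S. 0 \<le> P i j) \<and> ((\<lambda>j. P i j) has_sum 1) S)"

text \<open>
  Time-homogeneous discrete-time Markov chain. The conditional probability given the whole
  history is constrained only for histories of positive probability, since conditioning on a
  null event is meaningless (\<open>cond_prob\<close> would return \<open>0\<close> there).
\<close>

definition markov_chain ::
    "'a measure \<Rightarrow> 's set \<Rightarrow> ('s \<Rightarrow> 's \<Rightarrow> real) \<Rightarrow> (nat \<Rightarrow> 'a \<Rightarrow> 's) \<Rightarrow> bool" where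
  "markov_chain M S P X \<longleftrightarrow>
     prob_space M \<and> countable S \<and> stochastic_on S P \<and>
     (\<forall>n. X n \<in> M \<rightarrow>\<^sub>M count_space S) \<and>
     (\<forall>n x. \<forall>j\<in>S. \<P>(\<omega> in M. \<forall>i\<le>n. X i \<omega> = x i) > 0 \<longrightarrow>
        \<P>(\<omega> in M. X (Suc n) \<omega> = j \<bar> \<forall>i\<le>n. X i \<omega> = x i) = P (x n) j)"

text \<open>The infimum of the empty set is \<open>\<infinity>\<close>, the value on paths that never visit \<open>s\<close>.\<close>

definition first_visit :: "(nat \<Rightarrow> 'a \<Rightarrow> 's) \<Rightarrow> 's \<Rightarrow> 'a \<Rightarrow> enat" where
  "first_visit X s \<omega> = Inf {enat n | n. X n \<omega> = s}"

definition expected_first_visit :: "'a measure \<Rightarrow> (nat \<Rightarrow> 'a \<Rightarrow> 's) \<Rightarrow> 's \<Rightarrow> ennreal" where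
  "expected_first_visit M X s = (\<integral>\<^sup>+ \<omega>. ennreal_of_enat (first_visit X s \<omega>) \<partial>M)"

text \<open>
  \<open>K\<close> players, \<open>C\<close> channels, \<open>Q\<close> power levels, experimentation probability \<open>\<epsilon>\<close>;
  the real \<open>g\<close> is the constant \<open>G(\<Delta>u)\<close>.
\<close>

definition te_up_prob :: "nat \<Rightarrow> nat \<Rightarrow> nat \<Rightarrow> real \<Rightarrow> real \<Rightarrow> nat \<Rightarrow> real" where
  "te_up_prob K C Q \<epsilon> g k =
     (real K - real k) * ((real C - real k) / (real C * real Q)) * \<epsilon> powr (1 + g)"

text \<open>
  The dynamics is prescribed only until the Nash equilibrium state \<open>K\<close> is reached; the row
  of \<open>K\<close> is left arbitrary.
\<close>

definition te_transitions ::
    "nat \<Rightarrow> nat \<Rightarrow> nat \<Rightarrow> real \<Rightarrow> real \<Rightarrow> (nat \<Rightarrow> nat \<Rightarrow> real) \<Rightarrow> bool" where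
  "te_transitions K C Q \<epsilon> g P \<longleftrightarrow>
     (\<forall>k<K. \<forall>j\<in>{0..K}. P k j =
        (if j = Suc k then te_up_prob K C Q \<epsilon> g k
         else if j = k then 1 - te_up_prob K C Q \<epsilon> g k
         else 0))"

end

theory Submission
  imports Defs
begin

text \<open>
  The chain moves only from \<open>k\<close> to \<open>k + 1\<close>, so before absorption it spends an expected time
  \<open>1 / p\<^sub>k\<close> in state \<open>k\<close>, where \<open>p\<^sub>k\<close> is the probability of leaving \<open>k\<close>. Hence the expected
  hitting time is \<open>\<Sum>k<K. 1 / p\<^sub>k\<close>, and partial fractions turn this sum into
  \<open>(H\<^sub>K - H\<^sub>C + H\<^bsub>C-K\<^esub>) / (C - K)\<close> up to the factor \<open>C Q / \<epsilon>\<^bsup>1+g\<^esup>\<close>. The two bounds follow from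
  \<open>\<gamma> + ln K \<le> H\<^sub>K \<le> 1 + ln K\<close> and
  \<open>ln ((C + 1) / (C - K + 1)) \<le> H\<^sub>C - H\<^bsub>C-K\<^esub> \<le> ln (C / (C - K))\<close>.
\<close>

section \<open>Harmonic numbers\<close>

text \<open>Telescopes \<open>ln (x + 1) - ln x \<le> 1 / x\<close> at \<open>x = n + 1\<close>. The
  shift by one is the source of \<open>C + 1\<close> and \<open>C - K + 1\<close> in the upper
  bound.\<close>

lemma harm_diff_ge_ln:
  assumes "m \<le> n"
  shows "ln (real n + 1) - ln (real m + 1) \<le> harm n - harm m"
  using assms
proof (induction n rule: dec_induct)
  case (step n)
  then show ?case
    using ln_diff_le_inverse[of "real n + 1"]
    by (simp add: harm_Suc inverse_eq_divide add_ac)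
qed simp

text \<open>The sequence \<open>harm n - ln n\<close> decreases, so it stays above its
  limit.\<close>

lemma harm_ge_euler_mascheroni:
  assumes "n > 0"
  shows "euler_mascheroni + ln (real n) \<le> harm n"
proof -
  have "euler_mascheroni \<le> harm n - ln (real n)"
  proof (rule LIMSEQ_le_const2[OF euler_mascheroni_LIMSEQ])
    show "\<exists>N. \<forall>k\<ge>N. harm k - ln (real k) \<le> harm n - ln (real n)"
      using euler_mascheroni_sequence_decreasing[OF assms] by blast
  qed
  then show ?thesis by simp
qed

lemma sum_inverse_diff_eq_harm:
  assumes "m \<le> n"
  shows "(\<Sum>k<m. 1 / (real n - real k)) = harm n - harm (n - m)"
  using assms
proof (induction m)
  case (Suc m)
  then have "harm (n - m) = harm (n - Suc m) + 1 / (real n - real m)"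
    by (metis Suc_diff_Suc Suc_le_eq harm_Suc inverse_eq_divide of_nat_diff Suc_leD)
  with Suc show ?case by simp
qed simp

lemma sum_inverse_product_eq_harm:
  assumes "m < n"
  shows "(\<Sum>k<m. 1 / ((real m - real k) * (real n - real k)))
    = (harm m - harm n + harm (n - m)) / (real n - real m)"
proof -
  have "(\<Sum>k<m. 1 / ((real m - real k) * (real n - real k)))
      = (\<Sum>k<m. (1 / (real m - real k) - 1 / (real n - real k)) / (real n - real m))"
  proof (intro sum.cong refl)
    fix k assume "k \<in> {..<m}"
    then show "1 / ((real m - real k) * (real n - real k))
        = (1 / (real m - real k) - 1 / (real n - real k)) / (real n - real m)"
      using assms by (simp add: divide_simps)
  qed
  also have "\<dots> = (harm m - (harm n - harm (n - m))) / (real n - real m)"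
    using assms sum_inverse_diff_eq_harm[of m n] sum_inverse_diff_eq_harm[of m m]
    by (simp add: sum_divide_distrib[symmetric] sum_subtractf harm_expand(1))
  finally show ?thesis by simp
qed

section \<open>Occupation times and hitting times\<close>

text \<open>Meant for \<open>x n\<close> the probability of occupying a state at time
  \<open>n\<close>, \<open>q\<close> its exit probability and \<open>y n\<close> the inflow: total
  occupation times exit rate equals the initial mass plus all inflow.\<close>

lemma sums_affine_recurrence:
  fixes x y :: "nat \<Rightarrow> real"
  assumes rec: "\<And>n. x (Suc n) = (1 - q) * x n + y n"
    and x: "\<And>n. 0 \<le> x n" and y: "\<And>n. 0 \<le> y n"
    and sums: "y sums s" and q: "0 < q"
  shows "x sums ((x 0 + s) / q)"
proof -
  \<comment> \<open>Mass balance up to time \<open>n\<close>: what has left plus what is still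
    present is what was there or came in. With \<open>x \<ge> 0\<close> it bounds the partial
    sums.\<close>
  have partial: "q * sum x {..<n} + x n = x 0 + sum y {..<n}" for n
    by (induction n) (simp_all add: rec algebra_simps)
  have "summable x"
  proof (rule bounded_imp_summable)
    fix n
    have "q * sum x {..n} \<le> x 0 + s"
      using partial[of "Suc n"] x[of "Suc n"] sum_le_suminf[OF sums_summable[OF sums], of "{..<Suc n}"]
        y sums_unique[OF sums]
      by (simp add: lessThan_Suc_atMost)
    then show "sum x {..n} \<le> (x 0 + s) / q"
      using q by (simp add: field_simps)
  qed (rule x)
  then have x_sums: "x sums suminf x" by (rule summable_sums)
  \<comment> \<open>Summability forces \<open>x n\<close> to vanish in the limit, hence the
    \<open>+ 0\<close>.\<close>
  have "(\<lambda>n. x 0 + sum y {..<n}) \<longlonglongrightarrow> q * suminf x + 0"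
    unfolding partial[symmetric]
    using x_sums \<open>summable x\<close> unfolding sums_def
    by (intro tendsto_intros summable_LIMSEQ_zero)
  moreover have "(\<lambda>n. x 0 + sum y {..<n}) \<longlonglongrightarrow> x 0 + s"
    using sums unfolding sums_def by (intro tendsto_intros)
  ultimately have "q * suminf x = x 0 + s"
    using LIMSEQ_unique by fastforce
  then have "suminf x = (x 0 + s) / q"
    using q by (simp add: field_simps)
  with x_sums show ?thesis by simp
qed

lemma (in prob_space) prob_eq_sum_fibres:
  assumes f: "f \<in> space M \<rightarrow> I" and I: "finite I"
    and meas: "\<And>i. i \<in> I \<Longrightarrow> {\<omega> \<in> space M. A \<omega> \<and> f \<omega> = i} \<in> events"
  shows "\<P>(\<omega> in M. A \<omega>) = (\<Sum>i\<in>I. \<P>(\<omega> in M. A \<omega> \<and> f \<omega> = i))"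
proof -
  have "{\<omega> \<in> space M. A \<omega>} = (\<Union>i\<in>I. {\<omega> \<in> space M. A \<omega> \<and> f \<omega> = i})"
    using f by auto
  moreover have "disjoint_family_on (\<lambda>i. {\<omega> \<in> space M. A \<omega> \<and> f \<omega> = i}) I"
    by (auto simp: disjoint_family_on_def)
  ultimately show ?thesis
    using I meas by (simp add: finite_measure_finite_Union image_subset_iff)
qed

text \<open>The definition conditions on one complete history; here the past is any event
  \<open>R\<close> of the path up to time \<open>n\<close>. As \<open>S\<close> is finite, that
  event is a finite union of cylinders, each treated separately and then summed.\<close>

lemma markov_chain_step:
  fixes X :: "nat \<Rightarrow> 'a \<Rightarrow> 's"
  assumes mc: "markov_chain M S P X" and S: "finite S" and j: "j \<in> S"
  shows "\<P>(\<omega> in M. R (\<lambda>k\<in>{..n}. X k \<omega>) \<and> X n \<omega> = i \<and> X (Suc n) \<omega> = j)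
    = \<P>(\<omega> in M. R (\<lambda>k\<in>{..n}. X k \<omega>) \<and> X n \<omega> = i) * P i j"
proof -
  interpret prob_space M using mc by (simp add: markov_chain_def)
  have X[measurable]: "X k \<in> M \<rightarrow>\<^sub>M count_space S" for k
    using mc by (simp add: markov_chain_def)
  define h where "h \<omega> = (\<lambda>k\<in>{..n}. X k \<omega>)" for \<omega>
  define I where "I = ({..n} \<rightarrow>\<^sub>E S)"
  have I: "finite I" using S by (simp add: I_def finite_PiE)
  have h: "h \<in> space M \<rightarrow> I"
    using measurable_space[OF X] by (auto simp: h_def I_def)
  have h_eq: "h \<omega> = x \<longleftrightarrow> (\<forall>k\<le>n. X k \<omega> = x k)" if "x \<in> I" for x \<omega>
    using that by (auto simp: h_def I_def PiE_def extensional_def fun_eq_iff)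
  have h_n: "X n \<omega> = h \<omega> n" for \<omega> by (simp add: h_def)
  have cyl: "{\<omega> \<in> space M. h \<omega> = x} \<in> events" if "x \<in> I" for x
    unfolding h_eq[OF that] by measurable
  have cyl_step: "{\<omega> \<in> space M. h \<omega> = x \<and> X (Suc n) \<omega> = j} \<in> events" if "x \<in> I" for x
    unfolding h_eq[OF that] by measurable
  \<comment> \<open>Once the history is fixed to be \<open>x\<close>, \<open>R\<close> is a
    condition on \<open>x\<close> alone, so each fibre is a full cylinder or empty.\<close>
  have restr: "{\<omega> \<in> space M. (R (h \<omega>) \<and> h \<omega> n = i) \<and> h \<omega> = x}
      = (if R x \<and> x n = i then {\<omega> \<in> space M. h \<omega> = x} else {})"
    and restr_step: "{\<omega> \<in> space M. (R (h \<omega>) \<and> h \<omega> n = i \<and> X (Suc n) \<omega> = j) \<and> h \<omega> = x}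
      = (if R x \<and> x n = i then {\<omega> \<in> space M. h \<omega> = x \<and> X (Suc n) \<omega> = j} else {})" for x
    by auto
  have path: "\<P>(\<omega> in M. h \<omega> = x \<and> X (Suc n) \<omega> = j) = \<P>(\<omega> in M. h \<omega> = x) * P (x n) j"
    if x: "x \<in> I" for x
  \<comment> \<open>On null histories the chain hypothesis says nothing, but both sides are
    zero.\<close>
  proof (cases "\<P>(\<omega> in M. h \<omega> = x) = 0")
    case True
    then have "\<P>(\<omega> in M. h \<omega> = x \<and> X (Suc n) \<omega> = j) = 0"
      using finite_measure_mono[OF _ cyl[OF x],
          of "{\<omega> \<in> space M. h \<omega> = x \<and> X (Suc n) \<omega> = j}"] measure_nonneg[of M]
      by (smt (verit) Collect_mono_iff)
    with True show ?thesis by simp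
  next
    case False
    then have pos: "\<P>(\<omega> in M. \<forall>k\<le>n. X k \<omega> = x k) > 0"
      unfolding h_eq[OF x] by (simp add: zero_less_measure_iff)
    then have "\<P>(\<omega> in M. X (Suc n) \<omega> = j \<bar> \<forall>k\<le>n. X k \<omega> = x k) = P (x n) j"
      using mc j unfolding markov_chain_def by blast
    with pos show ?thesis
      unfolding h_eq[OF x] by (simp add: cond_prob_def field_simps conj_commute)
  qed
  have "\<P>(\<omega> in M. R (h \<omega>) \<and> h \<omega> n = i \<and> X (Suc n) \<omega> = j)
      = (\<Sum>x\<in>I. \<P>(\<omega> in M. (R (h \<omega>) \<and> h \<omega> n = i \<and> X (Suc n) \<omega> = j) \<and> h \<omega> = x))"
    by (rule prob_eq_sum_fibres[OF h I], unfold restr_step) (simp add: cyl_step)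
  also have "\<dots> = (\<Sum>x\<in>I. \<P>(\<omega> in M. (R (h \<omega>) \<and> h \<omega> n = i) \<and> h \<omega> = x) * P i j)"
    unfolding restr restr_step by (intro sum.cong refl) (auto simp: path)
  also have "\<dots> = \<P>(\<omega> in M. R (h \<omega>) \<and> h \<omega> n = i) * P i j"
    unfolding sum_distrib_right[symmetric]
    by (subst prob_eq_sum_fibres[OF h I, symmetric], unfold restr) (simp_all add: cyl)
  finally show ?thesis unfolding h_n by (simp add: h_def)
qed

section \<open>First visit times and their tail sums\<close>

lemma less_first_visit_iff: "enat n < first_visit X s \<omega> \<longleftrightarrow> (\<forall>i\<le>n. X i \<omega> \<noteq> s)"
proof
  assume less: "enat n < first_visit X s \<omega>"
  show "\<forall>i\<le>n. X i \<omega> \<noteq> s"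
  proof (intro allI impI notI)
    fix i assume "i \<le> n" "X i \<omega> = s"
    then have "first_visit X s \<omega> \<le> enat i"
      unfolding first_visit_def by (intro Inf_lower) blast
    also have "\<dots> \<le> enat n" using \<open>i \<le> n\<close> by simp
    finally show False using less by simp
  qed
next
  assume avoid: "\<forall>i\<le>n. X i \<omega> \<noteq> s"
  have "enat (Suc n) \<le> first_visit X s \<omega>"
    unfolding first_visit_def
    using avoid by (intro Inf_greatest) (auto simp: Suc_le_eq not_le[symmetric])
  then show "enat n < first_visit X s \<omega>"
    by (metis eSuc_enat ileI1 iless_Suc_eq order_less_le_trans lessI enat_ord_simps(2))
qed

text \<open>The smaller of two distinct values is finite and serves as the separating
  \<open>n\<close>. This writes each fibre of \<open>first_visit\<close> as a countable intersection
  of measurable events.\<close>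

lemma enat_eqI_less_iff:
  fixes a b :: enat
  assumes "\<And>n. enat n < a \<longleftrightarrow> enat n < b"
  shows "a = b"
proof (rule linorder_cases[of a b])
  assume "a < b"
  then obtain n where "a = enat n" by (cases a) auto
  with assms[of n] \<open>a < b\<close> show ?thesis by simp
next
  assume "b < a"
  then obtain n where "b = enat n" by (cases b) auto
  with assms[of n] \<open>b < a\<close> show ?thesis by simp
qed

text \<open>Tail-sum formula for the expectation of an extended natural number; it covers paths that
  never visit \<open>s\<close> as well.\<close>

lemma expected_first_visit_eq_suminf:
  fixes X :: "nat \<Rightarrow> 'a \<Rightarrow> 's"
  assumes X: "\<And>n. {\<omega> \<in> space M. X n \<omega> = s} \<in> sets M"
  shows "expected_first_visit M X s = (\<Sum>n. emeasure M {\<omega> \<in> space M. \<forall>i\<le>n. X i \<omega> \<noteq> s})"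
proof -
  have [measurable]: "Measurable.pred M (\<lambda>\<omega>. X n \<omega> = s)" for n
    using X by (simp add: pred_def)
  have "first_visit X s \<in> M \<rightarrow>\<^sub>M count_space UNIV"
  proof (subst measurable_count_space_eq_countable)
    show "first_visit X s \<in> space M \<rightarrow> UNIV \<and>
        (\<forall>t\<in>UNIV. first_visit X s -` {t} \<inter> space M \<in> sets M)"
    proof (intro conjI ballI)
      fix t :: enat
      have "first_visit X s -` {t} \<inter> space M
          = {\<omega> \<in> space M. \<forall>n. (\<forall>i\<le>n. X i \<omega> \<noteq> s) \<longleftrightarrow> enat n < t}"
        by (auto simp: less_first_visit_iff[symmetric] intro: enat_eqI_less_iff)
      also have "\<dots> \<in> sets M" by measurable
      finally show "first_visit X s -` {t} \<inter> space M \<in> sets M" .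
    qed simp
  qed auto
  then show ?thesis
    unfolding expected_first_visit_def
    by (simp add: nn_integral_enat_function less_first_visit_iff)
qed

section \<open>Pure birth chains\<close>

lemma pure_birth_expected_first_visit:
  fixes X :: "nat \<Rightarrow> 'a \<Rightarrow> nat" and p :: "nat \<Rightarrow> real"
  assumes mc: "markov_chain M {0..K} P X"
    and P: "\<And>k j. k < K \<Longrightarrow> j \<le> K \<Longrightarrow>
      P k j = (if j = Suc k then p k else if j = k then 1 - p k else 0)"
    and p: "\<And>k. k < K \<Longrightarrow> 0 < p k"
    and start: "AE \<omega> in M. X 0 \<omega> = 0"
  shows "expected_first_visit M X K = ennreal (\<Sum>k<K. 1 / p k)"
proof -
  interpret prob_space M using mc by (simp add: markov_chain_def)
  have X[measurable]: "X k \<in> M \<rightarrow>\<^sub>M count_space {0..K}" for k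
    using mc by (simp add: markov_chain_def)
  have X_le: "X k \<omega> \<le> K" if "\<omega> \<in> space M" for k \<omega>
    using measurable_space[OF X that] by simp
  have [measurable]: "Measurable.pred M (\<lambda>\<omega>. X k \<omega> = s)" for k s
    by measurable
  \<comment> \<open>Occupation probabilities of the chain killed at \<open>K\<close>. The row of
    \<open>K\<close> in \<open>P\<close> is arbitrary, so only paths that have not yet met
    \<open>K\<close> may be counted.\<close>
  define a where "a k n = \<P>(\<omega> in M. (\<forall>i\<le>n. X i \<omega> \<noteq> K) \<and> X n \<omega> = k)" for k n
  have a_K: "a K n = 0" for n
  proof -
    have "{\<omega> \<in> space M. (\<forall>i\<le>n. X i \<omega> \<noteq> K) \<and> X n \<omega> = K} = {}" by auto
    then show ?thesis by (simp only: a_def measure_empty)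
  qed
  have a_nonneg: "0 \<le> a k n" for k n
    by (simp add: a_def)
  have step: "a j (Suc n) = (\<Sum>k<K. a k n * P k j)" if "j < K" for j n
  proof -
    \<comment> \<open>Being at \<open>j < K\<close> at time \<open>Suc n\<close> already excludes
      \<open>K\<close> there, so avoidance is left as a condition on the past only.\<close>
    have "a j (Suc n) = \<P>(\<omega> in M. (\<forall>i\<le>n. X i \<omega> \<noteq> K) \<and> X (Suc n) \<omega> = j)"
      unfolding a_def using that by (auto simp: le_Suc_eq intro!: arg_cong[where f=prob])
    also have "\<dots> = (\<Sum>k\<in>{..K}. \<P>(\<omega> in M. ((\<forall>i\<le>n. X i \<omega> \<noteq> K) \<and> X (Suc n) \<omega> = j) \<and> X n \<omega> = k))"
      by (rule prob_eq_sum_fibres) (use X_le in auto)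
    also have "\<dots> = (\<Sum>k\<in>{..K}. a k n * P k j)"
    proof (intro sum.cong refl)
      fix k
      have "\<P>(\<omega> in M. ((\<forall>i\<le>n. X i \<omega> \<noteq> K) \<and> X (Suc n) \<omega> = j) \<and> X n \<omega> = k)
          = \<P>(\<omega> in M. (\<forall>i\<le>n. X i \<omega> \<noteq> K) \<and> X n \<omega> = k \<and> X (Suc n) \<omega> = j)"
        by (auto intro!: arg_cong[where f=prob])
      also have "\<dots> = a k n * P k j"
        using markov_chain_step[OF mc, of j "\<lambda>h. \<forall>i\<le>n. h i \<noteq> K" n k] that
        by (simp add: a_def)
      finally show "\<P>(\<omega> in M. ((\<forall>i\<le>n. X i \<omega> \<noteq> K) \<and> X (Suc n) \<omega> = j) \<and> X n \<omega> = k)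
          = a k n * P k j" .
    qed
    \<comment> \<open>The unknown row of \<open>K\<close> drops out because it has weight
      \<open>a K n = 0\<close>.\<close>
    also have "\<dots> = (\<Sum>k<K. a k n * P k j)"
      by (simp add: lessThan_Suc_atMost[symmetric] a_K)
    finally show ?thesis .
  qed
  have a_0: "a j 0 = (if j = 0 then 1 else 0)" if "j < K" for j
  proof -
    have "a j 0 = \<P>(\<omega> in M. j = 0)"
      unfolding a_def
      by (rule prob_eq_AE) (use start that in auto)
    then show ?thesis by (simp add: prob_space)
  qed
  \<comment> \<open>Exactly one unit of mass passes through each state below \<open>K\<close>: state
    0 starts with it, and state \<open>Suc j\<close> receives \<open>p j * a j n\<close>, whose sum
    is \<open>p j / p j = 1\<close>.\<close>
  have a_sums: "a j sums (1 / p j)" if "j < K" for j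
    using that
  proof (induction j)
    case 0
    have "a 0 (Suc n) = (1 - p 0) * a 0 n + 0" for n
    proof -
      have "a 0 (Suc n) = (\<Sum>k<K. if k = 0 then a 0 n * (1 - p 0) else 0)"
        unfolding step[OF 0] using 0 by (intro sum.cong) (auto simp: P)
      then show ?thesis using 0 by simp
    qed
    from sums_affine_recurrence[of "a 0" "p 0" "\<lambda>_. 0" 0, OF this]
    show ?case using 0 a_0[OF 0] p[OF 0] by (simp add: a_nonneg)
  next
    case (Suc j)
    have "a (Suc j) (Suc n) = (1 - p (Suc j)) * a (Suc j) n + p j * a j n" for n
    proof -
      have "a (Suc j) (Suc n) = (\<Sum>k<K. (if k = Suc j then a (Suc j) n * (1 - p (Suc j)) else 0)
          + (if k = j then a j n * p j else 0))"
        unfolding step[OF Suc.prems] using Suc.prems by (intro sum.cong) (auto simp: P)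
      then show ?thesis using Suc.prems by (simp add: sum.distrib)
    qed
    moreover have "(\<lambda>n. p j * a j n) sums 1"
      using sums_mult[OF Suc.IH, of "p j"] p[of j] Suc.prems by simp
    ultimately show ?case
      using sums_affine_recurrence[of "a (Suc j)" "p (Suc j)" "\<lambda>n. p j * a j n" 1]
        p[of j] p[of "Suc j"] a_0[OF Suc.prems] Suc.prems
      by (simp add: a_nonneg)
  qed
  have "prob {\<omega> \<in> space M. \<forall>i\<le>n. X i \<omega> \<noteq> K} = (\<Sum>k<K. a k n)" for n
  proof -
    have "prob {\<omega> \<in> space M. \<forall>i\<le>n. X i \<omega> \<noteq> K} = (\<Sum>k\<in>{..K}. a k n)"
      unfolding a_def by (rule prob_eq_sum_fibres) (use X_le in auto)
    then show ?thesis by (simp add: lessThan_Suc_atMost[symmetric] a_K)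
  qed
  then have avoid: "(\<lambda>n. prob {\<omega> \<in> space M. \<forall>i\<le>n. X i \<omega> \<noteq> K}) sums (\<Sum>k<K. 1 / p k)"
    using sums_sum[of "{..<K}" a "\<lambda>k. 1 / p k"] a_sums by simp
  have "expected_first_visit M X K
      = (\<Sum>n. ennreal (prob {\<omega> \<in> space M. \<forall>i\<le>n. X i \<omega> \<noteq> K}))"
    by (subst expected_first_visit_eq_suminf) (simp_all add: emeasure_eq_measure)
  also have "\<dots> = ennreal (\<Sum>k<K. 1 / p k)"
    using avoid by (intro suminf_ennreal_eq) simp_all
  finally show ?thesis .
qed

section \<open>The trial and error chain\<close>

theorem theorem6:
  fixes K C Q :: nat and \<epsilon> g :: real
    and M :: "'a measure" and P :: "nat \<Rightarrow> nat \<Rightarrow> real" and X :: "nat \<Rightarrow> 'a \<Rightarrow> nat"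
  assumes "K \<ge> 1" and "C > K" and "Q \<ge> 2"
    and "0 < \<epsilon>" and "\<epsilon> < 1"
    and "0 < g" and "g < 1 / 2"
    and "\<And>k. k < K \<Longrightarrow> te_up_prob K C Q \<epsilon> g k \<le> 1"
    and "te_transitions K C Q \<epsilon> g P"
    and "markov_chain M {0..K} P X"
    and "AE \<omega> in M. X 0 \<omega> = 0"
  defines "T \<equiv> expected_first_visit M X K"
  shows "T < \<infinity>
    \<and> enn2real T \<le> (real C * real Q) / (\<epsilon> powr (1 + g) * (real C - real K))
        * (1 + ln (real K * (real C - real K + 1) / (real C + 1)))
    \<and> enn2real T \<ge> (real C * real Q) / (\<epsilon> powr (1 + g) * (real C - real K))
        * (euler_mascheroni + ln (real K * (real C - real K) / real C))"
proof -
  define p where "p = te_up_prob K C Q \<epsilon> g"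
  define A where "A = (real C * real Q) / (\<epsilon> powr (1 + g) * (real C - real K))"
  define h :: real where "h = harm K - harm C + harm (C - K)"
  have A: "A \<ge> 0" using \<open>C > K\<close> by (simp add: A_def)
  have p: "p k > 0" if "k < K" for k
    using that \<open>C > K\<close> \<open>Q \<ge> 2\<close> \<open>0 < \<epsilon>\<close> by (simp add: p_def te_up_prob_def)
  have "T = ennreal (\<Sum>k<K. 1 / p k)"
    unfolding T_def
    by (rule pure_birth_expected_first_visit[OF \<open>markov_chain M {0..K} P X\<close> _ p])
      (use \<open>te_transitions K C Q \<epsilon> g P\<close> \<open>AE \<omega> in M. X 0 \<omega> = 0\<close>
        in \<open>simp_all add: te_transitions_def p_def\<close>)
  \<comment> \<open>Nonnegativity lets \<open>enn2real\<close> undo \<open>ennreal\<close> without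
    truncation.\<close>
  moreover have "0 \<le> (\<Sum>k<K. 1 / p k)"
    using p by (intro sum_nonneg) (simp add: less_imp_le)
  moreover have "(\<Sum>k<K. 1 / p k) = A * h"
  proof -
    have "(\<Sum>k<K. 1 / p k) = (real C * real Q / \<epsilon> powr (1 + g))
        * (\<Sum>k<K. 1 / ((real K - real k) * (real C - real k)))"
      unfolding sum_distrib_left by (simp add: p_def te_up_prob_def field_simps)
    also have "\<dots> = A * h"
      unfolding sum_inverse_product_eq_harm[OF \<open>C > K\<close>] by (simp add: A_def h_def)
    finally show ?thesis .
  qed
  ultimately have T: "T < \<infinity>" "enn2real T = A * h"
    by simp_all
  \<comment> \<open>Comparing \<open>harm n - ln n\<close> at \<open>1\<close> and \<open>K\<close>
    gives \<open>harm K \<le> 1 + ln K\<close>.\<close>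
  have "h \<le> 1 + ln (real K * (real C - real K + 1) / (real C + 1))"
    using euler_mascheroni_sequence_decreasing[of 1 K] harm_diff_ge_ln[of "C - K" C]
      \<open>K \<ge> 1\<close> \<open>C > K\<close>
    by (simp add: h_def harm_expand ln_mult ln_div)
  \<comment> \<open>The same monotonicity between \<open>C - K\<close> and \<open>C\<close> bounds
    \<open>harm C - harm (C - K)\<close> above by \<open>ln C - ln (C - K)\<close>.\<close>
  moreover have "euler_mascheroni + ln (real K * (real C - real K) / real C) \<le> h"
    using harm_ge_euler_mascheroni[of K] euler_mascheroni_sequence_decreasing[of "C - K" C]
      \<open>K \<ge> 1\<close> \<open>C > K\<close>
    by (simp add: h_def ln_mult ln_div)
  ultimately show ?thesis
    unfolding T A_def[symmetric] using A T(1) by (simp add: mult_left_mono)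
qed

end
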